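(* Let $A,B\in\mathbb{R}^{n\times n}$ be symmetric matrices with $B$ positive definite and let $(\bar A,\bar B)$ be the scaled pencil $$\bar A=A+Vf(D_2)V^T,\qquad \bar B=B+Vg(D_2)V^T,$$ where $f$, $g$ are two functions defined on the spectrum of $(A,B)$, $V=BU_2\in\mathbb{R}^{n\times r}$, with $U_2=[\mathbf{u}_{n-r+1},\dots,\mathbf{u}_n]$ the matrix formed by the last $r$ $B$-orthonormal eigenvectors of $(A,B)$ and $D_2=\operatorname{diag}(\lambda_{n-r+1},\dots,\lambda_n)\in\mathbb{R}^{r\times r}$ the diagonal matrix formed by the last $r$ eigenvalues of $(A,B)$, with $r\ll n$. Then: - The eigenvectors of $(A,B)$ and $(\bar A,\bar B)$ are the same. - The eigenvalues of $(\bar A,\bar B)$ are given by $$\bar\lambda_{i_k}=\begin{cases}\lambda_k & \text{for } k=1,\dots,n-r,\\[2pt] \dfrac{\lambda_k+f(\lambda_k)}{1+g(\lambda_k)} & \text{for } k=n-r+1,\dots,n.\end{cases}$$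
   Context: For a pair $(A,B)$ of real $n\times n$ matrices, an eigenvalue $\lambda$ with eigenvector $\mathbf{u}\neq 0$ satisfies $A\mathbf{u}=\lambda B\mathbf{u}$; the spectrum of $(A,B)$ is the set of its eigenvalues. For symmetric $A$ and symmetric positive definite $B$, all eigenvalues of $(A,B)$ are real and there is an invertible matrix $U=[\mathbf{u}_1,\dots,\mathbf{u}_n]\in\mathbb{R}^{n\times n}$ with $U^TAU=\operatorname{diag}(\lambda_1,\dots,\lambda_n)$ and $U^TBU=I$; its columns are the $B$-orthonormal eigenvectors $\mathbf{u}_k$, with corresponding eigenvalues $\lambda_k$. The eigenvalues are ordered increasingly, $\lambda_1\le\dots\le\lambda_n$. For a diagonal matrix, $f(\operatorname{diag}(d_1,\dots,d_r))=\operatorname{diag}(f(d_1),\dots,f(d_r))$, and likewise for $g$. The index $i_k$ denotes the position, in the numbering of the eigenvalues of $(\bar A,\bar B)$, of the eigenvalue obtained from $\lambda_k$.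
   Formalization: Assumes 1+g(λ_k)≠0 for the last r indices; all u_k are shown to be eigenvectors of both pencils, but equality of the full sets of eigenvectors is claimed only if the scaling neither merges distinct eigenvalues nor splits equal ones (it fails otherwise). *)

theory Defs
  imports
    Complex_Main
    "HOL-Combinatorics.Permutations"
    "Jordan_Normal_Form.Matrix"
    "Jordan_Normal_Form.Determinant"
    "Jordan_Normal_Form.Char_Poly"
begin

text \<open>Rows, columns and eigenvalue numberings are 0-based: index \<open>k < n\<close> stands for the
  conventional index \<open>k + 1\<close>.\<close>

definition pos_def_mat :: "real mat \<Rightarrow> bool" where
  "pos_def_mat B \<longleftrightarrow> square_mat B \<and> B\<^sup>T = B \<and>
     (\<forall>v \<in> carrier_vec (dim_row B). v \<noteq> 0\<^sub>v (dim_row B) \<longrightarrow> v \<bullet> (B *\<^sub>v v) > 0)"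

definition pencil_eigenvector :: "'a::comm_ring_1 mat \<Rightarrow> 'a mat \<Rightarrow> 'a vec \<Rightarrow> 'a \<Rightarrow> bool" where
  "pencil_eigenvector A B u z \<longleftrightarrow>
     u \<in> carrier_vec (dim_col A) \<and> u \<noteq> 0\<^sub>v (dim_col A) \<and> A *\<^sub>v u = z \<cdot>\<^sub>v (B *\<^sub>v u)"

text \<open>The spectrum of a real pencil consists of all complex eigenvalues, so that reality of the
  eigenvalues is a claim and not a convention.\<close>

definition pencil_spectrum :: "real mat \<Rightarrow> real mat \<Rightarrow> complex set" where
  "pencil_spectrum A B =
     {z. \<exists>u. pencil_eigenvector (map_mat complex_of_real A) (map_mat complex_of_real B) u z}"

text \<open>\<open>det (x B - A)\<close> as a polynomial in \<open>x\<close>\<close>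

definition pencil_char_poly :: "'a::comm_ring_1 mat \<Rightarrow> 'a mat \<Rightarrow> 'a poly" where
  "pencil_char_poly A B =
     det ([:0, 1:] \<cdot>\<^sub>m map_mat (\<lambda>b. [:b:]) B + map_mat (\<lambda>a. [:- a:]) A)"

text \<open>\<open>\<mu> 0 \<le> \<dots> \<le> \<mu> (n - 1)\<close> lists all eigenvalues of the regular pencil \<open>(A, B)\<close>, each repeated
  according to its algebraic multiplicity; values of \<open>\<mu>\<close> beyond \<open>n\<close> are irrelevant.\<close>

definition eigenvalue_numbering :: "nat \<Rightarrow> real mat \<Rightarrow> real mat \<Rightarrow> (nat \<Rightarrow> real) \<Rightarrow> bool" where
  "eigenvalue_numbering n A B \<mu> \<longleftrightarrow>
     (\<forall>i j. i \<le> j \<longrightarrow> j < n \<longrightarrow> \<mu> i \<le> \<mu> j) \<and>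
     (let p = pencil_char_poly (map_mat complex_of_real A) (map_mat complex_of_real B)
      in p \<noteq> 0 \<and> (\<forall>z. order z p = card {i. i < n \<and> complex_of_real (\<mu> i) = z}))"

definition pencil_eigenbasis ::
    "nat \<Rightarrow> real mat \<Rightarrow> real mat \<Rightarrow> real mat \<Rightarrow> (nat \<Rightarrow> real) \<Rightarrow> bool" where
  "pencil_eigenbasis n A B U lam \<longleftrightarrow>
     U \<in> carrier_mat n n \<and> invertible_mat U \<and>
     U\<^sup>T * A * U = mat_diag n lam \<and> U\<^sup>T * B * U = 1\<^sub>m n \<and>
     (\<forall>i j. i \<le> j \<longrightarrow> j < n \<longrightarrow> lam i \<le> lam j)"

definition last_cols :: "nat \<Rightarrow> 'a mat \<Rightarrow> 'a mat" where
  "last_cols r U = mat_of_cols (dim_row U) (map (col U) [dim_col U - r..<dim_col U])"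

text \<open>Only meant for diagonal matrices: \<open>f\<close> is applied to the diagonal entries.\<close>

definition diag_fun :: "(real \<Rightarrow> real) \<Rightarrow> real mat \<Rightarrow> real mat" where
  "diag_fun f D = mat_diag (dim_row D) (\<lambda>i. f (D $$ (i, i)))"

end

theory Submission
  imports Defs
begin

text \<open>Write \<open>E = U\<^sup>T V = U\<^sup>T B U\<^sub>2\<close>. Since \<open>U\<^sup>T B U = I\<close>, the matrix \<open>E\<close> consists of the last \<open>r\<close>
  columns of the identity, so \<open>U\<^sup>T (V H V\<^sup>T) U = E H E\<^sup>T\<close> is the diagonal \<open>H\<close> moved into the last
  \<open>r\<close> diagonal positions (\<open>congruence_of_update\<close>). Hence the congruence by \<open>U\<close> that turns \<open>(A, B)\<close>
  into \<open>(diag \<lambda>, I)\<close> also turns the scaled pencil into a diagonal pencil \<open>(diag a, diag b)\<close>: in the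
  first \<open>n - r\<close> places \<open>a\<^sub>k = \<lambda>\<^sub>k\<close> and \<open>b\<^sub>k = 1\<close>, in the others \<open>a\<^sub>k = \<lambda>\<^sub>k + f(\<lambda>\<^sub>k)\<close> and
  \<open>b\<^sub>k = 1 + g(\<lambda>\<^sub>k)\<close>, which is nonzero.

  Everything claimed can be read off such a diagonal form, and this is the purpose of the locale
  below. In the coordinates given by \<open>U\<close>, the equation \<open>A u = z B u\<close> decouples into
  \<open>a\<^sub>i c\<^sub>i = z b\<^sub>i c\<^sub>i\<close>, so that \<open>z\<close> has to equal \<open>a\<^sub>i / b\<^sub>i\<close> wherever \<open>c\<^sub>i\<close> is nonzero
  (\<open>eigenvector_coordinates\<close>). This determines the eigenvectors and the eigenvalues. Algebraic
  multiplicities come from the factorisation of \<open>det (x B - A)\<close>, up to the constant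
  \<open>(det U)\<^sup>2\<close>, into the linear factors \<open>b\<^sub>i x - a\<^sub>i\<close> (\<open>char_poly_factorisation\<close>). The spectrum
  ranges over complex numbers, so the locale is stated over an arbitrary field and is used both for
  the real pencil and for its complexification. Since the scaling may destroy the
  order of the eigenvalues, the numbering of the new ones is obtained by sorting.\<close>

section \<open>Pencils diagonalised by a congruence\<close>

lemma mult_vec_cancel:
  assumes M: "(M :: 'a::field mat) \<in> carrier_mat n n" "det M \<noteq> 0"
    and u: "u \<in> carrier_vec n" and v: "v \<in> carrier_vec n" and eq: "M *\<^sub>v u = M *\<^sub>v v"
  shows "u = v"
proof -
  from M u v eq have "M *\<^sub>v (u - v) = 0\<^sub>v n"
    by (simp add: mult_minus_distrib_mat_vec)
  with M u v det_0_iff_vec_prod_zero_field[OF M(1)] have "u - v = 0\<^sub>v n"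
    by (metis minus_carrier_vec)
  with u v show ?thesis
    by (intro eq_vecI) (auto simp: vec_eq_iff)
qed

text \<open>The transformed \<open>B\<close> is allowed to be any invertible diagonal matrix, because \<open>U\<close> is in general not
  orthonormal with respect to the scaled matrix \<open>B + V g(D\<^sub>2) V\<^sup>T\<close>.\<close>

locale diagonalised_pencil =
  fixes n :: nat and A B U :: "'a::field mat" and a b :: "nat \<Rightarrow> 'a"
  assumes A: "A \<in> carrier_mat n n" and B: "B \<in> carrier_mat n n" and U: "U \<in> carrier_mat n n"
    and det_U: "det U \<noteq> 0"
    and diag_A: "U\<^sup>T * A * U = mat_diag n a" and diag_B: "U\<^sup>T * B * U = mat_diag n b"
    and b_nz: "\<And>i. i < n \<Longrightarrow> b i \<noteq> 0"
begin

text \<open>As \<open>U\<^sup>T\<close> is injective, multiplying \<open>A u = z B u\<close> by it loses nothing; what remains is one scalar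
  equation for each coordinate.\<close>

lemma eigenvector_coordinates:
  assumes c: "c \<in> carrier_vec n"
  shows "pencil_eigenvector A B (U *\<^sub>v c) z \<longleftrightarrow>
    c \<noteq> 0\<^sub>v n \<and> (\<forall>i < n. c $ i \<noteq> 0 \<longrightarrow> z = a i / b i)"
proof -
  have diag_mult: "mat_diag n d *\<^sub>v c = vec n (\<lambda>i. d i * c $ i)" for d
    using c by (intro eq_vecI) (auto simp: mat_diag_def scalar_prod_def if_distrib if_distribR cong: if_cong)
  have pull: "U\<^sup>T *\<^sub>v (C *\<^sub>v (U *\<^sub>v c)) = (U\<^sup>T * C * U) *\<^sub>v c" if "C \<in> carrier_mat n n" for C
    using that U c by (simp add: assoc_mult_mat_vec[of _ n n _ n])
  have "A *\<^sub>v (U *\<^sub>v c) = z \<cdot>\<^sub>v (B *\<^sub>v (U *\<^sub>v c)) \<longleftrightarrow>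
      U\<^sup>T *\<^sub>v (A *\<^sub>v (U *\<^sub>v c)) = U\<^sup>T *\<^sub>v (z \<cdot>\<^sub>v (B *\<^sub>v (U *\<^sub>v c)))"
    (is "?u = ?v \<longleftrightarrow> U\<^sup>T *\<^sub>v ?u = U\<^sup>T *\<^sub>v ?v")
  proof
    assume "U\<^sup>T *\<^sub>v ?u = U\<^sup>T *\<^sub>v ?v"
    moreover have "U\<^sup>T \<in> carrier_mat n n" "det U\<^sup>T \<noteq> 0" "?u \<in> carrier_vec n" "?v \<in> carrier_vec n"
      using A B U c det_U by (simp_all add: det_transpose)
    ultimately show "?u = ?v"
      by (intro mult_vec_cancel[of "U\<^sup>T" n ?u ?v])
  qed simp
  also have "U\<^sup>T *\<^sub>v (z \<cdot>\<^sub>v (B *\<^sub>v (U *\<^sub>v c))) = z \<cdot>\<^sub>v (U\<^sup>T *\<^sub>v (B *\<^sub>v (U *\<^sub>v c)))"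
    using B U c by (simp add: mult_mat_vec[of _ n n])
  also have "U\<^sup>T *\<^sub>v (A *\<^sub>v (U *\<^sub>v c)) = z \<cdot>\<^sub>v (U\<^sup>T *\<^sub>v (B *\<^sub>v (U *\<^sub>v c))) \<longleftrightarrow>
      (\<forall>i < n. a i * c $ i = z * (b i * c $ i))"
    unfolding pull[OF A] pull[OF B] diag_A diag_B diag_mult by (auto simp: vec_eq_iff)
  also have "\<dots> \<longleftrightarrow> (\<forall>i < n. c $ i \<noteq> 0 \<longrightarrow> z = a i / b i)"
    using b_nz by (auto simp: field_simps)
  finally have eq: "A *\<^sub>v (U *\<^sub>v c) = z \<cdot>\<^sub>v (B *\<^sub>v (U *\<^sub>v c)) \<longleftrightarrow>
      (\<forall>i < n. c $ i \<noteq> 0 \<longrightarrow> z = a i / b i)" .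
  have "U *\<^sub>v c = 0\<^sub>v n \<longleftrightarrow> c = 0\<^sub>v n"
  proof
    have "U *\<^sub>v 0\<^sub>v n = 0\<^sub>v n"
      using U by (intro eq_vecI) auto
    then show "c = 0\<^sub>v n \<Longrightarrow> U *\<^sub>v c = 0\<^sub>v n" "U *\<^sub>v c = 0\<^sub>v n \<Longrightarrow> c = 0\<^sub>v n"
      using mult_vec_cancel[OF U det_U c zero_carrier_vec] by simp_all
  qed
  then show ?thesis
    using A U c by (auto simp: pencil_eigenvector_def eq)
qed

lemma eigenvector_col:
  assumes "k < n"
  shows "pencil_eigenvector A B (col U k) (a k / b k)"
proof -
  have "col U k = U *\<^sub>v unit_vec n k"
    using U assms by (intro eq_vecI) auto
  moreover have "unit_vec n k \<noteq> (0\<^sub>v n :: 'a vec)"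
    using assms by simp
  moreover have "\<forall>i < n. unit_vec n k $ i \<noteq> (0 :: 'a) \<longrightarrow> a k / b k = a i / b i"
    using assms by simp
  ultimately show ?thesis
    using eigenvector_coordinates[of "unit_vec n k" "a k / b k"] by simp
qed

lemma coordinatesE:
  assumes "u \<in> carrier_vec n"
  obtains c where "c \<in> carrier_vec n" "u = U *\<^sub>v c"
proof -
  from det_non_zero_imp_unit[OF U det_U] U
  obtain W where W: "W \<in> carrier_mat n n" "U * W = 1\<^sub>m n"
    unfolding Units_def ring_mat_def by auto
  have "u = U *\<^sub>v (W *\<^sub>v u)"
    unfolding assoc_mult_mat_vec[OF U W(1) assms, symmetric] W(2) using assms by simp
  then show ?thesis
    using assms W(1) by (intro that[of "W *\<^sub>v u"]) simp_all
qed

text \<open>A nonzero linear combination of the columns of \<open>U\<close> is an eigenvector exactly when all columns involved share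
  their eigenvalue. Thus the set of eigenvectors depends on the eigenvalues only through the
  partition of the indices into groups of equal ones.\<close>

lemma eigenvectors_eq:
  "{u. \<exists>z. pencil_eigenvector A B u z} =
    (*\<^sub>v) U ` {c \<in> carrier_vec n. c \<noteq> 0\<^sub>v n \<and>
      (\<forall>i < n. \<forall>j < n. c $ i \<noteq> 0 \<longrightarrow> c $ j \<noteq> 0 \<longrightarrow> a i / b i = a j / b j)}"
  (is "?L = ?R")
proof (intro equalityI subsetI)
  fix u assume "u \<in> ?L"
  then obtain z where z: "pencil_eigenvector A B u z"
    by blast
  then have "u \<in> carrier_vec n"
    using A by (simp add: pencil_eigenvector_def)
  then obtain c where c: "c \<in> carrier_vec n" "u = U *\<^sub>v c"
    by (rule coordinatesE)
  with z have "c \<noteq> 0\<^sub>v n" and same: "\<forall>i < n. c $ i \<noteq> 0 \<longrightarrow> z = a i / b i"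
    by (simp_all add: eigenvector_coordinates)
  moreover from same have "\<forall>i < n. \<forall>j < n. c $ i \<noteq> 0 \<longrightarrow> c $ j \<noteq> 0 \<longrightarrow> a i / b i = a j / b j"
    by metis
  ultimately show "u \<in> ?R"
    using c by blast
next
  fix u assume "u \<in> ?R"
  then obtain c where c: "c \<in> carrier_vec n" "c \<noteq> 0\<^sub>v n" "u = U *\<^sub>v c"
    and same: "\<And>i j. i < n \<Longrightarrow> j < n \<Longrightarrow> c $ i \<noteq> 0 \<Longrightarrow> c $ j \<noteq> 0 \<Longrightarrow> a i / b i = a j / b j"
    by blast
  from c obtain k where "k < n" "c $ k \<noteq> 0"
    by (auto simp: vec_eq_iff)
  with same have "pencil_eigenvector A B u (a k / b k)"
    unfolding c(3) eigenvector_coordinates[OF c(1)] using c(2) by blast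
  then show "u \<in> ?L"
    by blast
qed

lemma eigenvalues_eq: "{z. \<exists>u. pencil_eigenvector A B u z} = (\<lambda>k. a k / b k) ` {..<n}"
proof (intro equalityI subsetI)
  fix z assume "z \<in> {z. \<exists>u. pencil_eigenvector A B u z}"
  then obtain u where u: "pencil_eigenvector A B u z"
    by blast
  then have "u \<in> carrier_vec n"
    using A by (simp add: pencil_eigenvector_def)
  then obtain c where c: "c \<in> carrier_vec n" "u = U *\<^sub>v c"
    by (rule coordinatesE)
  with u have "c \<noteq> 0\<^sub>v n" and z: "\<forall>i < n. c $ i \<noteq> 0 \<longrightarrow> z = a i / b i"
    by (simp_all add: eigenvector_coordinates)
  then obtain k where "k < n" "c $ k \<noteq> 0"
    using c(1) by (auto simp: vec_eq_iff)
  with z show "z \<in> (\<lambda>k. a k / b k) ` {..<n}"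
    by blast
qed (auto intro: eigenvector_col)

text \<open>The congruence by \<open>U\<close> is carried out on the matrix \<open>x B - A\<close> over the polynomial ring, where it yields
  a diagonal matrix; both outer factors contribute \<open>det U\<close> to the determinant.\<close>

lemma char_poly_factorisation:
  "Polynomial.smult (det U ^ 2) (pencil_char_poly A B) = (\<Prod>i<n. [:- a i, b i:])"
proof -
  interpret const: comm_ring_hom "\<lambda>c::'a. [:c:]"
    by unfold_locales (auto simp: one_pCons)
  let ?P = "map_mat (\<lambda>c::'a. [:c:])"
  have neg: "map_mat (\<lambda>a. [:- a:]) C = - ?P C" for C :: "'a mat"
    by auto
  have congr: "?P U\<^sup>T * ?P C * ?P U = ?P (U\<^sup>T * C * U)" if "C \<in> carrier_mat n n" for C
    using that U by (simp add: const.mat_hom_mult[of _ n n _ n])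
  define M where "M = [:0, 1:] \<cdot>\<^sub>m ?P B + - ?P A"
  have M: "M \<in> carrier_mat n n"
    using A B by (simp add: M_def)
  have "?P U\<^sup>T * M * ?P U = [:0, 1:] \<cdot>\<^sub>m (?P U\<^sup>T * ?P B * ?P U) + - (?P U\<^sup>T * ?P A * ?P U)"
    unfolding M_def using A B U
    by (simp add: mult_add_distrib_mat[of _ n n _ n] add_mult_distrib_mat[of _ n n _ _ n]
        mult_smult_distrib[of _ n n _ n] mult_smult_assoc_mat[of _ n n _ n])
  also have "\<dots> = mat_diag n (\<lambda>i. [:- a i, b i:])"
    unfolding congr[OF A] congr[OF B] diag_A diag_B
    by (intro eq_matI) (auto simp: mat_diag_def)
  finally have "det (?P U\<^sup>T * M * ?P U) = det (mat_diag n (\<lambda>i. [:- a i, b i:]))"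
    by simp
  also have "\<dots> = (\<Prod>i<n. [:- a i, b i:])"
    by (subst det_upper_triangular[of _ n])
      (auto simp: mat_diag_def diag_mat_def prod.list_conv_set_nth lessThan_atLeast0 intro!: prod.cong)
  also have "det (?P U\<^sup>T * M * ?P U) = [:det U:] * det M * [:det U:]"
    using U M by (simp add: det_mult[of _ n] det_transpose)
  finally show ?thesis
    by (simp add: pencil_char_poly_def neg M_def power2_eq_square mult.commute)
qed

lemma char_poly_nz: "pencil_char_poly A B \<noteq> 0"
proof
  assume "pencil_char_poly A B = 0"
  with char_poly_factorisation have "(\<Prod>i<n. [:- a i, b i:]) = 0"
    by simp
  then show False
    using b_nz by auto
qed

lemma order_char_poly: "order z (pencil_char_poly A B) = card {i. i < n \<and> a i / b i = z}"
proof -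
  have order_linear: "order z [:- a i, b i:] = (if a i / b i = z then 1 else 0)" if "i < n" for i
  proof -
    have factor: "[:- a i, b i:] = Polynomial.smult (b i) ([:- (a i / b i), 1:] ^ 1)"
      using b_nz[OF that] by simp
    have "order z [:- a i, b i:] = order z ([:- (a i / b i), 1:] ^ 1)"
      unfolding factor using b_nz[OF that] by (rule order_smult)
    also have "\<dots> = (if a i / b i = z then 1 else 0)"
      using order_power_n_n[of "a i / b i" 1] by (auto intro!: order_0I)
    finally show ?thesis .
  qed
  have "order z (pencil_char_poly A B) = order z (\<Prod>i<n. [:- a i, b i:])"
    unfolding char_poly_factorisation[symmetric] using det_U by (simp add: order_smult)
  also have "order z (\<Prod>i<m. [:- a i, b i:]) = (\<Sum>i<m. if a i / b i = z then 1 else 0)"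
    if "m \<le> n" for m
    using that
  proof (induction m)
    case (Suc m)
    have "(\<Prod>i<m. [:- a i, b i:]) * [:- a m, b m:] \<noteq> 0"
      using Suc.prems b_nz by (intro no_zero_divisors) auto
    from order_mult[OF this] show ?case
      using Suc order_linear[of m] by (simp only: prod.lessThan_Suc sum.lessThan_Suc)
  qed simp
  from this[of n] have "order z (\<Prod>i<n. [:- a i, b i:]) = (\<Sum>i<n. if a i / b i = z then 1 else 0)"
    by simp
  also have "\<dots> = card {i. i < n \<and> a i / b i = z}"
    by (simp add: sum.If_cases Int_def)
  finally show ?thesis .
qed

end

section \<open>Real pencils and the numbering of their eigenvalues\<close>

lemma diagonalised_pencil_complex:
  assumes "diagonalised_pencil n A B U a b"
  shows "diagonalised_pencil n (map_mat complex_of_real A) (map_mat complex_of_real B)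
    (map_mat complex_of_real U) (\<lambda>i. complex_of_real (a i)) (\<lambda>i. complex_of_real (b i))"
proof -
  interpret diagonalised_pencil n A B U a b by fact
  have congr: "(map_mat complex_of_real U)\<^sup>T * map_mat complex_of_real C * map_mat complex_of_real U =
      map_mat complex_of_real (U\<^sup>T * C * U)" if "C \<in> carrier_mat n n" for C
    using that U by (simp add: of_real_hom.mat_hom_mult[of _ n n _ n] map_mat_transpose)
  have diag: "map_mat complex_of_real (mat_diag n d) = mat_diag n (\<lambda>i. complex_of_real (d i))" for d
    by (auto simp: mat_diag_def)
  show ?thesis
  proof unfold_locales
    show "(map_mat complex_of_real U)\<^sup>T * map_mat complex_of_real A * map_mat complex_of_real U =
        mat_diag n (\<lambda>i. complex_of_real (a i))"
      unfolding congr[OF A] diag_A diag ..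
    show "(map_mat complex_of_real U)\<^sup>T * map_mat complex_of_real B * map_mat complex_of_real U =
        mat_diag n (\<lambda>i. complex_of_real (b i))"
      unfolding congr[OF B] diag_B diag ..
  qed (use A B U det_U b_nz in auto)
qed

lemma sorting_permutation:
  fixes \<mu> :: "nat \<Rightarrow> 'a::linorder"
  obtains \<nu> i where "i permutes {..<n}" "\<And>k. k < n \<Longrightarrow> \<nu> (i k) = \<mu> k"
    "\<And>j k. j \<le> k \<Longrightarrow> k < n \<Longrightarrow> \<nu> j \<le> \<nu> k"
proof -
  define ys where "ys = sort (map \<mu> [0..<n])"
  have len: "length ys = n"
    by (simp add: ys_def)
  obtain i where i: "i permutes {..<length ys}" "permute_list i ys = map \<mu> [0..<n]"
    by (rule mset_eq_permutation[of "map \<mu> [0..<n]" ys]) (simp_all add: ys_def)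
  show thesis
  proof (rule that[of i "(!) ys"])
    show "i permutes {..<n}"
      using i(1) len by simp
    show "ys ! i k = \<mu> k" if "k < n" for k
      using that i permute_list_nth[OF i(1), of k] len by simp
    show "ys ! j \<le> ys ! k" if "j \<le> k" "k < n" for j k
      using that len sorted_nth_mono[of ys] by (simp add: ys_def)
  qed
qed

text \<open>The quotients \<open>a\<^sub>k / b\<^sub>k\<close> need not be increasing in \<open>k\<close>. Sorting them gives the numbering \<open>\<nu>\<close>, and
  a permutation of the indices preserves how often each value occurs, that is, the algebraic
  multiplicities.\<close>

lemma eigenvalue_numbering_exists:
  assumes "diagonalised_pencil n A B U a b"
  obtains \<nu> i where "eigenvalue_numbering n A B \<nu>" "i permutes {..<n}"
    "\<And>k. k < n \<Longrightarrow> \<nu> (i k) = a k / b k"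
proof -
  interpret C: diagonalised_pencil n "map_mat complex_of_real A" "map_mat complex_of_real B"
    "map_mat complex_of_real U" "\<lambda>i. complex_of_real (a i)" "\<lambda>i. complex_of_real (b i)"
    using assms by (rule diagonalised_pencil_complex)
  obtain \<nu> i where i: "i permutes {..<n}" and \<nu>: "\<And>k. k < n \<Longrightarrow> \<nu> (i k) = a k / b k"
    and mono: "\<And>j k. j \<le> k \<Longrightarrow> k < n \<Longrightarrow> \<nu> j \<le> \<nu> k"
    by (rule sorting_permutation[of n "\<lambda>k. a k / b k"]) blast
  have quotient: "complex_of_real (a k) / complex_of_real (b k) = complex_of_real (\<nu> (i k))"
    if "k < n" for k
    unfolding \<nu>[OF that] by (rule of_real_divide[symmetric])
  have "card {k. k < n \<and> complex_of_real (a k) / complex_of_real (b k) = z} =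
      card {l. l < n \<and> complex_of_real (\<nu> l) = z}" (is "card ?K = card ?L") for z
  proof (rule bij_betw_same_card, rule bij_betw_imageI)
    show "inj_on i ?K"
      by (rule permutes_inj_on[OF i])
    show "i ` ?K = ?L"
    proof (intro equalityI subsetI)
      fix l assume l: "l \<in> ?L"
      then have "l \<in> i ` {..<n}"
        unfolding permutes_image[OF i] by blast
      then obtain k where k: "k < n" "l = i k"
        by blast
      with l have "k \<in> ?K"
        using quotient by simp
      with k(2) show "l \<in> i ` ?K"
        by (rule image_eqI)
    next
      fix l assume "l \<in> i ` ?K"
      then obtain k where k: "k < n" "complex_of_real (a k) / complex_of_real (b k) = z" "l = i k"
        by blast
      moreover from k(1) have "i k < n"
        using permutes_in_image[OF i, of k] by simp
      ultimately show "l \<in> ?L"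
        using quotient[OF k(1)] by simp
    qed
  qed
  then have "eigenvalue_numbering n A B \<nu>"
    using mono C.char_poly_nz by (simp add: eigenvalue_numbering_def C.order_char_poly)
  with i \<nu> that show thesis
    by blast
qed

section \<open>Updates built from the last basis vectors\<close>

lemma last_cols_carrier:
  assumes "U \<in> carrier_mat m n" "r \<le> n"
  shows "last_cols r U \<in> carrier_mat m r"
  using assms by (auto simp: last_cols_def intro!: carrier_matI)

lemma mult_last_cols:
  assumes "C \<in> carrier_mat m n" "U \<in> carrier_mat n n" "r \<le> n"
  shows "C * last_cols r U = last_cols r (C * U)"
  using assms by (intro eq_matI) (auto simp: last_cols_def mat_of_cols_index mult_mat_vec_def)

lemma last_cols_one_diag:
  assumes "r \<le> n"
  shows "last_cols r (1\<^sub>m n) * mat_diag r d * (last_cols r (1\<^sub>m n))\<^sup>T =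
    mat_diag n (\<lambda>i. if i < n - r then 0 else (d (i - (n - r)) :: 'a::comm_ring_1))"
proof -
  let ?E = "last_cols r (1\<^sub>m n) :: 'a mat"
  have E: "?E \<in> carrier_mat n r"
    using assms by (intro last_cols_carrier) auto
  have entry: "?E $$ (i, l) = (if i = n - r + l then 1 else 0)" if "i < n" "l < r" for i l
    using that assms by (auto simp: last_cols_def mat_of_cols_index)
  show ?thesis
  proof (rule eq_matI)
    fix i j assume ij: "i < dim_row (mat_diag n (\<lambda>i. if i < n - r then 0 else d (i - (n - r))))"
      "j < dim_col (mat_diag n (\<lambda>i. if i < n - r then 0 else d (i - (n - r))))"
    then have ij: "i < n" "j < n"
      by (simp_all add: mat_diag_def)
    have "(?E * mat_diag r d * ?E\<^sup>T) $$ (i, j) = (\<Sum>l<r. ?E $$ (i, l) * d l * ?E $$ (j, l))"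
      using E ij by (simp add: mat_diag_mult_right scalar_prod_def lessThan_atLeast0)
    also have "\<dots> = (\<Sum>l<r. if l = i - (n - r) then if i = j \<and> n - r \<le> i then d l else 0 else 0)"
      using ij by (intro sum.cong) (auto simp: entry)
    also have "\<dots> = mat_diag n (\<lambda>i. if i < n - r then 0 else d (i - (n - r))) $$ (i, j)"
      using ij assms by (auto simp: mat_diag_def)
    finally show "(?E * mat_diag r d * ?E\<^sup>T) $$ (i, j) =
      mat_diag n (\<lambda>i. if i < n - r then 0 else d (i - (n - r))) $$ (i, j)" .
  qed (use E in \<open>auto simp: mat_diag_def\<close>)
qed

text \<open>The orthonormality \<open>U\<^sup>T B U = I\<close> turns \<open>U\<^sup>T V\<close> into the last \<open>r\<close> columns of the identity, so the
  update changes only the last \<open>r\<close> diagonal entries of the transformed matrix. The matrix \<open>C\<close>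
  stands for either member of the pencil.\<close>

lemma congruence_of_update:
  assumes C: "C \<in> carrier_mat n n" and B: "B \<in> carrier_mat n n" and U: "U \<in> carrier_mat n n"
    and diag_C: "U\<^sup>T * C * U = mat_diag n d" and orthonormal: "U\<^sup>T * B * U = 1\<^sub>m n"
    and r: "r \<le> n" and V: "V = B * last_cols r U"
  shows "U\<^sup>T * (C + V * mat_diag r h * V\<^sup>T) * U =
    mat_diag n (\<lambda>k. if k < n - r then d k else d k + (h (k - (n - r)) :: 'a::comm_ring_1))"
proof -
  have U2: "last_cols r U \<in> carrier_mat n r"
    using U r by (simp add: last_cols_carrier)
  with B V have V_dim: "V \<in> carrier_mat n r"
    by simp
  have UV: "U\<^sup>T * V = last_cols r (1\<^sub>m n)"
    unfolding V orthonormal[symmetric] using B U U2 r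
    by (simp add: mult_last_cols[of _ n n] flip: assoc_mult_mat[of _ n n _ n _ r])
  have VU: "V\<^sup>T * U = (last_cols r (1\<^sub>m n))\<^sup>T"
    unfolding UV[symmetric] using U V_dim by (simp add: transpose_mult[of _ n n _ r])
  have UT: "U\<^sup>T \<in> carrier_mat n n" and update: "V * mat_diag r h * V\<^sup>T \<in> carrier_mat n n"
    using U V_dim by auto
  have "U\<^sup>T * (C + V * mat_diag r h * V\<^sup>T) * U =
      U\<^sup>T * C * U + U\<^sup>T * (V * mat_diag r h * V\<^sup>T) * U"
    unfolding mult_add_distrib_mat[OF UT C update]
    by (rule add_mult_distrib_mat[OF mult_carrier_mat[OF UT C] mult_carrier_mat[OF UT update] U])
  also have "U\<^sup>T * (V * mat_diag r h * V\<^sup>T) * U = (U\<^sup>T * V) * mat_diag r h * (V\<^sup>T * U)"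
  proof -
    let ?G = "mat_diag r h"
    have dims: "U\<^sup>T * V * ?G \<in> carrier_mat n r" "V * ?G \<in> carrier_mat n r"
      "V\<^sup>T \<in> carrier_mat r n"
      using V_dim mult_carrier_mat[OF mult_carrier_mat[OF UT V_dim] mat_diag_dim]
        mult_carrier_mat[OF V_dim mat_diag_dim] by simp_all
    have "U\<^sup>T * (V * ?G * V\<^sup>T) = U\<^sup>T * V * ?G * V\<^sup>T"
      unfolding assoc_mult_mat[OF UT V_dim mat_diag_dim] assoc_mult_mat[OF UT dims(2,3)] ..
    then show ?thesis
      using assoc_mult_mat[OF dims(1,3) U] by simp
  qed
  also have "\<dots> = mat_diag n (\<lambda>i. if i < n - r then 0 else h (i - (n - r)))"
    unfolding UV VU by (rule last_cols_one_diag[OF r])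
  also have "U\<^sup>T * C * U + \<dots> =
      mat_diag n (\<lambda>k. if k < n - r then d k else d k + h (k - (n - r)))"
    unfolding diag_C by (intro eq_matI) (auto simp: mat_diag_def)
  finally show ?thesis .
qed

section \<open>The scaled pencil\<close>

theorem theorem4p3:
  fixes n r :: nat
    and A B U U2 D2 V Abar Bbar :: "real mat"
    and lam lam' :: "nat \<Rightarrow> real"
    and f g :: "real \<Rightarrow> real"
  assumes A: "A \<in> carrier_mat n n" "A\<^sup>T = A"
    and B: "B \<in> carrier_mat n n" "pos_def_mat B"
    and U: "pencil_eigenbasis n A B U lam"
    and r: "r \<le> n"
    and U2: "U2 = last_cols r U"
    and D2: "D2 = mat_diag r (\<lambda>j. lam (n - r + j))"
    and V: "V = B * U2"
    and Abar: "Abar = A + V * diag_fun f D2 * V\<^sup>T"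
    and Bbar: "Bbar = B + V * diag_fun g D2 * V\<^sup>T"
    and g: "\<forall>k \<in> {n - r..<n}. 1 + g (lam k) \<noteq> 0"
    and lam': "lam' = (\<lambda>k. if k < n - r then lam k else (lam k + f (lam k)) / (1 + g (lam k)))"
  shows
    "(\<forall>k < n. pencil_eigenvector A B (col U k) (lam k) \<and>
              pencil_eigenvector Abar Bbar (col U k) (lam' k)) \<and>
     \<comment> \<open>even the sets of all eigenvectors agree, unless distinct eigenvalues are merged or a
        multiple eigenvalue is split up by the scaling\<close>
     ((\<forall>j < n. \<forall>k < n. lam j = lam k \<longleftrightarrow> lam' j = lam' k) \<longrightarrow>
        {u. \<exists>z. pencil_eigenvector Abar Bbar u z} = {u. \<exists>z. pencil_eigenvector A B u z}) \<and>
     pencil_spectrum Abar Bbar = (\<lambda>k. complex_of_real (lam' k)) ` {..<n} \<and>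
     (\<exists>lambar i. eigenvalue_numbering n Abar Bbar lambar \<and> i permutes {..<n} \<and>
        (\<forall>k < n - r. lambar (i k) = lam k) \<and>
        (\<forall>k \<in> {n - r..<n}. lambar (i k) = (lam k + f (lam k)) / (1 + g (lam k))))"
proof -
  from U have U_dim: "U \<in> carrier_mat n n"
    and diag_A: "U\<^sup>T * A * U = mat_diag n lam" and diag_B: "U\<^sup>T * B * U = 1\<^sub>m n"
    by (auto simp: pencil_eigenbasis_def)
  have det_U: "det U \<noteq> 0"
  proof
    assume "det U = 0"
    moreover have "det (U\<^sup>T * B * U) = det U\<^sup>T * det B * det U"
      using U_dim B(1) by (simp add: det_mult[of _ n])
    ultimately show False
      by (simp add: diag_B)
  qed
  have diag_fun_D2: "diag_fun h D2 = mat_diag r (\<lambda>j. h (lam (n - r + j)))" for h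
    by (auto simp: diag_fun_def D2 mat_diag_def)
  have "V \<in> carrier_mat n r"
    using B(1) U_dim r by (simp add: V U2 last_cols_carrier)
  then have dims: "Abar \<in> carrier_mat n n" "Bbar \<in> carrier_mat n n"
    using A(1) B(1) by (auto simp: Abar Bbar diag_fun_D2)
  \<comment> \<open>the redundant \<open>n - r + (k - (n - r))\<close> is the form in which the diagonal entries of
    \<open>f(D\<^sub>2)\<close> and \<open>g(D\<^sub>2)\<close> appear after the congruence\<close>
  define a where "a k = (if k < n - r then lam k else lam k + f (lam (n - r + (k - (n - r)))))" for k
  define b where "b k = (if k < n - r then 1 else 1 + g (lam (n - r + (k - (n - r)))))" for k
  have diag_Abar: "U\<^sup>T * Abar * U = mat_diag n a"
    unfolding Abar diag_fun_D2 a_def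
    by (rule congruence_of_update[OF A(1) B(1) U_dim diag_A diag_B r V[unfolded U2]])
  have diag_Bbar: "U\<^sup>T * Bbar * U = mat_diag n b"
    unfolding Bbar diag_fun_D2 b_def
    by (rule congruence_of_update[OF B(1) B(1) U_dim _ diag_B r V[unfolded U2]]) (simp add: diag_B)
  have quotient: "a k / b k = lam' k" for k
    by (simp add: a_def b_def lam')
  interpret orig: diagonalised_pencil n A B U lam "\<lambda>_. 1"
    using A(1) B(1) U_dim det_U diag_A diag_B by unfold_locales auto
  have scaled: "diagonalised_pencil n Abar Bbar U a b"
    using dims U_dim det_U diag_Abar diag_Bbar g by unfold_locales (auto simp: b_def)
  interpret scaled: diagonalised_pencil n Abar Bbar U a b
    by (rule scaled)
  interpret cscaled: diagonalised_pencil n "map_mat complex_of_real Abar"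
    "map_mat complex_of_real Bbar" "map_mat complex_of_real U"
    "\<lambda>k. complex_of_real (a k)" "\<lambda>k. complex_of_real (b k)"
    by (rule diagonalised_pencil_complex[OF scaled])
  have "pencil_eigenvector A B (col U k) (lam k)"
    "pencil_eigenvector Abar Bbar (col U k) (lam' k)" if "k < n" for k
    using orig.eigenvector_col[OF that] scaled.eigenvector_col[OF that] by (simp_all add: quotient)
  moreover have "{u. \<exists>z. pencil_eigenvector Abar Bbar u z} = {u. \<exists>z. pencil_eigenvector A B u z}"
    if "\<forall>j < n. \<forall>k < n. lam j = lam k \<longleftrightarrow> lam' j = lam' k"
    unfolding orig.eigenvectors_eq scaled.eigenvectors_eq quotient
    using that by (intro image_cong Collect_cong) auto
  moreover have "pencil_spectrum Abar Bbar = (\<lambda>k. complex_of_real (lam' k)) ` {..<n}"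
    unfolding pencil_spectrum_def cscaled.eigenvalues_eq by (simp flip: of_real_divide add: quotient)
  moreover obtain lambar i where "eigenvalue_numbering n Abar Bbar lambar" "i permutes {..<n}"
    "\<And>k. k < n \<Longrightarrow> lambar (i k) = lam' k"
    using eigenvalue_numbering_exists[OF scaled] unfolding quotient by blast
  then have "\<exists>lambar i. eigenvalue_numbering n Abar Bbar lambar \<and> i permutes {..<n} \<and>
        (\<forall>k < n - r. lambar (i k) = lam k) \<and>
        (\<forall>k \<in> {n - r..<n}. lambar (i k) = (lam k + f (lam k)) / (1 + g (lam k)))"
    by (intro exI[of _ lambar] exI[of _ i]) (auto simp: lam')
  ultimately show ?thesis
    by blast
qed

end
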